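(* Let $(p_n)_{n\in\mathbb{N}}$ be a sequence of real numbers such that either $p_n\in[1,2)$ for all $n\in\mathbb{N}$ or $p_n\in(2,\infty)$ for all $n\in\mathbb{N}$. If $S:\ell^{(p_n)}\to\ell^{(p_n)}$ is an isomodular operator, then there exist a regular set isomorphism $T$ of $\mathbb{N}$ and a function $h\in\ell^\infty$ such that $$(Sx)_n=h(n)\,(Tx)_n$$ for all $x\in\ell^{(p_n)}$ and $n\in\mathbb{N}$. Furthermore, $|h(n)|\le 1$ for all $n\in\mathbb{N}$.
   Context: Here $\mathbb{N}=\{1,2,3,\dots\}$ and $\mathbb{C}^\infty$ is the space of all complex sequences $a=(a_n)_{n\in\mathbb{N}}$. For a sequence $(p_n)$ in $[1,\infty)$, the variable-exponent space is $\ell^{(p_n)}:=\{a\in\mathbb{C}^\infty : \sum_{n\in\mathbb{N}}|a_n|^{p_n}<\infty\}$, treated as a complex vector space, and the modular on it is $\varrho(a):=\sum_{n\in\mathbb{N}}|a_n|^{p_n}$ for $a\in\ell^{(p_n)}$. In the case $p_n\in(2,\infty)$ the sequence $(p_n)$ is not assumed bounded. $\ell^\infty$ is the space of bounded complex-valued functions on $\mathbb{N}$. A linear operator $S:\ell^{(p_n)}\to\ell^{(p_n)}$ is called isomodular if $\varrho(Sa)=\varrho(a)$ for all $a\in\ell^{(p_n)}$. A regular set isomorphism of $\mathbb{N}$ is a mapping $T:\mathcal{P}(\mathbb{N})\to\mathcal{P}(\mathbb{N})$ on the power set of $\mathbb{N}$ such that, for all $A,A_1,A_2,\dots\in\mathcal{P}(\mathbb{N})$: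 (i) $T(\mathbb{N}\setminus A)=T(\mathbb{N})\setminus T(A)$; (ii) $T\left(\bigcup_{n=1}^\infty A_n\right)=\bigcup_{n=1}^\infty T(A_n)$; (iii) $T(A)=\emptyset$ if and only if $A=\emptyset$. For such $T$ the sets $T(\{k\})$, $k\in\mathbb{N}$, are pairwise disjoint, and for $a\in\ell^{(p_n)}$ one defines the sequence $Ta\in\ell^\infty$ by $(Ta)_n=a_k$ when $n\in T(\{k\})$, and $(Ta)_n=0$ if $n$ belongs to no $T(\{k\})$. *)

theory Defs
  imports "HOL-Analysis.Analysis"
begin

text \<open>
  The index set \<open>\<nat> = {1, 2, 3, \<dots>}\<close> is represented by the type \<^typ>\<open>nat\<close>, that is, indices are
  shifted by one; nothing below depends on the arithmetic or the order of the indices.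
\<close>

definition vexp_space :: "(nat \<Rightarrow> real) \<Rightarrow> (nat \<Rightarrow> complex) set" where
  "vexp_space p = {a. summable (\<lambda>n. cmod (a n) powr p n)}"

definition modular :: "(nat \<Rightarrow> real) \<Rightarrow> (nat \<Rightarrow> complex) \<Rightarrow> real" where
  "modular p a = (\<Sum>n. cmod (a n) powr p n)"

definition ell_infinity :: "(nat \<Rightarrow> complex) set" where
  "ell_infinity = {a. bounded (range a)}"

text \<open>
  For bounded \<open>p\<close> the set \<^term>\<open>vexp_space p\<close> is a complex vector space and the following is
  ordinary linearity on it. For unbounded \<open>p\<close> the set need not be closed under addition and scalar
  multiplication, so additivity and homogeneity are required exactly where both sides make sense.
  As the set is always absolutely convex, such an \<open>S\<close> is the restriction of a
  linear operator on its linear span. Only the values of \<open>S\<close> on \<^term>\<open>vexp_space p\<close> matter.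
\<close>

definition linear_operator :: "(nat \<Rightarrow> real) \<Rightarrow> ((nat \<Rightarrow> complex) \<Rightarrow> (nat \<Rightarrow> complex)) \<Rightarrow> bool" where
  "linear_operator p S \<longleftrightarrow>
     (\<forall>x \<in> vexp_space p. S x \<in> vexp_space p) \<and>
     (\<forall>x \<in> vexp_space p. \<forall>y \<in> vexp_space p. (\<lambda>n. x n + y n) \<in> vexp_space p \<longrightarrow>
        S (\<lambda>n. x n + y n) = (\<lambda>n. S x n + S y n)) \<and>
     (\<forall>c. \<forall>x \<in> vexp_space p. (\<lambda>n. c * x n) \<in> vexp_space p \<longrightarrow>
        S (\<lambda>n. c * x n) = (\<lambda>n. c * S x n))"

definition isomodular :: "(nat \<Rightarrow> real) \<Rightarrow> ((nat \<Rightarrow> complex) \<Rightarrow> (nat \<Rightarrow> complex)) \<Rightarrow> bool" where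
  "isomodular p S \<longleftrightarrow>
     linear_operator p S \<and> (\<forall>a \<in> vexp_space p. modular p (S a) = modular p a)"

definition regular_set_isomorphism :: "(nat set \<Rightarrow> nat set) \<Rightarrow> bool" where
  "regular_set_isomorphism T \<longleftrightarrow>
     (\<forall>A. T (UNIV - A) = T UNIV - T A) \<and>
     (\<forall>A :: nat \<Rightarrow> nat set. T (\<Union>n. A n) = (\<Union>n. T (A n))) \<and>
     (\<forall>A. T A = {} \<longleftrightarrow> A = {})"

definition induced_map :: "(nat set \<Rightarrow> nat set) \<Rightarrow> (nat \<Rightarrow> complex) \<Rightarrow> (nat \<Rightarrow> complex)" where
  "induced_map T a = (\<lambda>n. if \<exists>k. n \<in> T {k} then a (THE k. n \<in> T {k}) else 0)"

lemma regular_set_isomorphism_mono: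
  assumes T: "regular_set_isomorphism T" and sub: "A \<subseteq> B"
  shows "T A \<subseteq> T B"
proof -
  define F where "F = (\<lambda>n::nat. if n = 0 then A else B)"
  have "T (\<Union>n. F n) = (\<Union>n. T (F n))"
    using T by (simp only: regular_set_isomorphism_def)
  moreover have "(\<Union>n. F n) = B"
  proof (intro equalityI UN_least)
    show "F n \<subseteq> B" for n using sub by (simp add: F_def)
    show "B \<subseteq> (\<Union>n. F n)" using UN_upper[of "Suc 0" UNIV F] by (simp add: F_def)
  qed
  moreover have "T A \<subseteq> (\<Union>n. T (F n))"
    using UN_upper[of 0 UNIV "\<lambda>n. T (F n)"] by (simp add: F_def)
  ultimately show ?thesis by simp
qed

lemma regular_set_isomorphism_disjoint:
  assumes T: "regular_set_isomorphism T" and "j \<noteq> k"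
  shows "T {j} \<inter> T {k} = {}"
proof -
  have "T {j} \<subseteq> T (UNIV - {k})"
    using assms(2) by (intro regular_set_isomorphism_mono[OF T]) simp
  also have "\<dots> = T UNIV - T {k}"
    using T by (simp only: regular_set_isomorphism_def)
  finally show ?thesis by blast
qed

lemma induced_map_eq:
  assumes T: "regular_set_isomorphism T" and n: "n \<in> T {k}"
  shows "induced_map T a n = a k"
proof -
  have "(THE k. n \<in> T {k}) = k"
  proof (rule the_equality)
    show "n \<in> T {k}" by (rule n)
  next
    fix j assume "n \<in> T {j}"
    then show "j = k"
      using n regular_set_isomorphism_disjoint[OF T, of j k] by (cases "j = k") auto
  qed
  moreover have "\<exists>k. n \<in> T {k}" using n by (rule exI)
  ultimately show ?thesis by (simp add: induced_map_def)
qed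

lemma induced_map_eq_0: "(\<And>k. n \<notin> T {k}) \<Longrightarrow> induced_map T a n = 0"
  by (simp add: induced_map_def)

end

theory Submission
  imports Defs
begin

text \<open>
  This is Lamperti's argument. The Clarkson-type inequality
  \<open>|z + w|^p + |z - w|^p \<le> 2 (|z|^p + |w|^p)\<close> for \<open>p < 2\<close> (reversed for \<open>p > 2\<close>) is strict
  unless \<open>z w = 0\<close>. Vectors \<open>x\<close>, \<open>y\<close> with disjoint supports attain equality after summation, and an
  isomodular \<open>S\<close> transports this equality to \<open>S x\<close>, \<open>S y\<close>; hence equality holds in every coordinate
  and \<open>S x\<close>, \<open>S y\<close> have disjoint supports again. The images of the unit vectors therefore have
  disjoint nonempty supports, which give \<open>T\<close>, and their entries give \<open>h\<close>. The modulars of the tails of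
  \<open>x\<close> tend to \<open>0\<close>, so that \<open>S x\<close> is the coordinatewise sum of the images of the components of \<open>x\<close>.
\<close>

section \<open>Clarkson-type inequalities\<close>

text \<open>Midpoint convexity of t^q for positive \<open>u\<close>, \<open>v\<close>; when one of
  them vanishes, (1/2)^q \<le> 1/2 suffices.\<close>

lemma midpoint_powr_le:
  fixes u v q :: real
  assumes "u \<ge> 0" "v \<ge> 0" "q \<ge> 1"
  shows "2 * ((u + v) / 2) powr q \<le> u powr q + v powr q"
proof -
  have half: "2 * (t / 2) powr q \<le> t powr q" if "t \<ge> 0" for t :: real
  proof -
    have "2 * (t / 2) powr q = (2 * (1/2) powr q) * t powr q"
      using that by (simp add: powr_divide)
    also have "(1/2::real) powr q \<le> (1/2) powr 1"
      using assms by (intro powr_mono') auto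
    then have "(2 * (1/2) powr q) * t powr q \<le> 1 * t powr q"
      by (intro mult_right_mono) auto
    finally show ?thesis by simp
  qed
  show ?thesis
  proof (cases "u = 0 \<or> v = 0")
    case True
    then show ?thesis using half[of u] half[of v] assms by auto
  next
    case False
    have "(((1 - 1/2) *\<^sub>R u + (1/2) *\<^sub>R v)) powr q \<le> (1 - 1/2) * u powr q + (1/2) * v powr q"
      using False assms by (intro convex_onD[OF powr_convex]) auto
    then show ?thesis by (simp add: field_simps)
  qed
qed

text \<open>The convex case for the exponent 1/q, applied to u^q and v^q; raising both sides to the
  power \<open>q\<close> gives the claim.\<close>

lemma midpoint_powr_ge:
  fixes u v q :: real
  assumes "u \<ge> 0" "v \<ge> 0" "0 < q" "q \<le> 1"
  shows "u powr q + v powr q \<le> 2 * ((u + v) / 2) powr q"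
proof -
  let ?m = "(u powr q + v powr q) / 2"
  have "2 * ?m powr (1/q) \<le> (u powr q) powr (1/q) + (v powr q) powr (1/q)"
    using assms by (intro midpoint_powr_le) auto
  then have "?m powr (1/q) \<le> (u + v) / 2"
    using assms by (simp add: powr_powr)
  then have "(?m powr (1/q)) powr q \<le> ((u + v) / 2) powr q"
    using assms by (intro powr_mono2) auto
  then show ?thesis using assms by (simp add: powr_powr)
qed

lemma powr_eq_mult_powr_minus_one:
  "0 \<le> x \<Longrightarrow> x powr q = x * x powr (q - 1)" for x q :: real
  using powr_mult_base[of x "q - 1"] by simp

text \<open>Split t^q as t * t^(q-1): for q < 1 the second factor strictly decreases, so replacing
  \<open>u + v\<close> in it by \<open>u\<close> or \<open>v\<close> increases each term.\<close>

lemma powr_add_strict_subadditive: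
  fixes u v q :: real
  assumes "u > 0" "v > 0" "q < 1"
  shows "(u + v) powr q < u powr q + v powr q"
proof -
  have "(u + v) powr q = u * (u + v) powr (q - 1) + v * (u + v) powr (q - 1)"
    using assms by (subst powr_eq_mult_powr_minus_one) (auto simp: algebra_simps)
  also have "\<dots> < u * u powr (q - 1) + v * v powr (q - 1)"
    using assms by (intro add_strict_mono mult_strict_left_mono powr_less_mono2_neg) auto
  also have "\<dots> = u powr q + v powr q"
    using assms by (simp flip: powr_eq_mult_powr_minus_one)
  finally show ?thesis .
qed

lemma powr_add_strict_superadditive:
  fixes u v q :: real
  assumes "u > 0" "v > 0" "q > 1"
  shows "u powr q + v powr q < (u + v) powr q"
proof -
  have "u powr q + v powr q = u * u powr (q - 1) + v * v powr (q - 1)"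
    using assms by (simp flip: powr_eq_mult_powr_minus_one)
  also have "\<dots> < u * (u + v) powr (q - 1) + v * (u + v) powr (q - 1)"
    using assms by (intro add_strict_mono mult_strict_left_mono powr_less_mono2) auto
  also have "\<dots> = (u + v) powr q"
    using assms by (subst (3) powr_eq_mult_powr_minus_one) (auto simp: algebra_simps)
  finally show ?thesis .
qed

text \<open>Passing to squared moduli and exponent p/2 makes the parallelogram law applicable and
  places the threshold p = 2 at exponent 1.\<close>

lemma cmod_powr_eq: "cmod z powr p = ((cmod z)\<^sup>2) powr (p / 2)"
  by (cases "z = 0") (simp_all add: powr_powr flip: powr_numeral)

lemma parallelogram_law_midpoint:
  "((cmod (z + w))\<^sup>2 + (cmod (z - w))\<^sup>2) / 2 = (cmod z)\<^sup>2 + (cmod w)\<^sup>2"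
  unfolding cmod_power2 by (simp add: power2_eq_square field_simps)

text \<open>The midpoint inequality with exponent p/2 combines with the parallelogram law;
  strictness comes from strict subadditivity, as both moduli are positive.\<close>

lemma clarkson_less:
  assumes "0 < p" "p < 2" "z \<noteq> 0" "w \<noteq> 0"
  shows "cmod (z + w) powr p + cmod (z - w) powr p < 2 * (cmod z powr p + cmod w powr p)"
proof -
  have "cmod (z + w) powr p + cmod (z - w) powr p \<le> 2 * ((cmod z)\<^sup>2 + (cmod w)\<^sup>2) powr (p/2)"
    using midpoint_powr_ge[of "(cmod (z + w))\<^sup>2" "(cmod (z - w))\<^sup>2" "p/2"] assms
    unfolding parallelogram_law_midpoint cmod_powr_eq[symmetric] by simp
  also have "\<dots> < 2 * (cmod z powr p + cmod w powr p)"
    using powr_add_strict_subadditive[of "(cmod z)\<^sup>2" "(cmod w)\<^sup>2" "p/2"] assms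
    unfolding cmod_powr_eq[symmetric] by simp
  finally show ?thesis .
qed

lemma clarkson_greater:
  assumes "2 < p" "z \<noteq> 0" "w \<noteq> 0"
  shows "2 * (cmod z powr p + cmod w powr p) < cmod (z + w) powr p + cmod (z - w) powr p"
proof -
  have "2 * (cmod z powr p + cmod w powr p) < 2 * ((cmod z)\<^sup>2 + (cmod w)\<^sup>2) powr (p/2)"
    using powr_add_strict_superadditive[of "(cmod z)\<^sup>2" "(cmod w)\<^sup>2" "p/2"] assms
    unfolding cmod_powr_eq[symmetric] by simp
  also have "\<dots> \<le> cmod (z + w) powr p + cmod (z - w) powr p"
    using midpoint_powr_le[of "(cmod (z + w))\<^sup>2" "(cmod (z - w))\<^sup>2" "p/2"] assms
    unfolding parallelogram_law_midpoint cmod_powr_eq[symmetric] by simp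
  finally show ?thesis .
qed

lemma clarkson_eq:
  assumes "z = 0 \<or> w = 0"
  shows "cmod (z + w) powr p + cmod (z - w) powr p = 2 * (cmod z powr p + cmod w powr p)"
  using assms by auto

lemma suminf_eq_imp_eq:
  fixes f g :: "nat \<Rightarrow> real"
  assumes "summable f" "summable g" "\<And>n. f n \<le> g n" "suminf f = suminf g"
  shows "f n = g n"
proof -
  have "(\<Sum>n. g n - f n) = 0"
    using assms by (simp flip: suminf_diff)
  then show ?thesis
    using suminf_eq_zero_iff[of "\<lambda>n. g n - f n"] assms by (simp add: summable_diff)
qed

section \<open>Isomodular operators\<close>

lemma vexp_spaceD: "a \<in> vexp_space p \<Longrightarrow> summable (\<lambda>n. cmod (a n) powr p n)"
  by (simp add: vexp_space_def)

lemma vexp_space_mono: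
  assumes "a \<in> vexp_space p" "\<And>n. p n \<ge> 0" "\<And>n. cmod (b n) \<le> cmod (a n)"
  shows "b \<in> vexp_space p"
  unfolding vexp_space_def mem_Collect_eq
  by (rule summable_comparison_test'[OF vexp_spaceD[OF assms(1)], of 0])
    (auto intro!: powr_mono2 assms)

lemma vexp_space_finite_support:
  assumes "finite {n. a n \<noteq> 0}"
  shows "a \<in> vexp_space p"
  unfolding vexp_space_def mem_Collect_eq
  using assms by (rule summable_finite) auto

text \<open>In each coordinate one summand vanishes, so the series splits. Membership of the sum is
  not automatic for unbounded \<open>p\<close>, and additivity of an operator presupposes
  it.\<close>

lemma
  assumes x: "x \<in> vexp_space p" and y: "y \<in> vexp_space p"
    and disj: "\<And>n. x n = 0 \<or> y n = 0"
  shows vexp_space_add_disjoint: "(\<lambda>n. x n + y n) \<in> vexp_space p"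
    and modular_add_disjoint: "modular p (\<lambda>n. x n + y n) = modular p x + modular p y"
proof -
  have eq: "(\<lambda>n. cmod (x n + y n) powr p n) = (\<lambda>n. cmod (x n) powr p n + cmod (y n) powr p n)"
  proof
    show "cmod (x n + y n) powr p n = cmod (x n) powr p n + cmod (y n) powr p n" for n
      using disj[of n] by auto
  qed
  show "(\<lambda>n. x n + y n) \<in> vexp_space p"
    unfolding vexp_space_def mem_Collect_eq eq
    by (intro summable_add vexp_spaceD x y)
  show "modular p (\<lambda>n. x n + y n) = modular p x + modular p y"
    unfolding modular_def eq by (intro suminf_add[symmetric] vexp_spaceD x y)
qed

definition unit_seq :: "nat \<Rightarrow> nat \<Rightarrow> complex" where
  "unit_seq k = (\<lambda>n. of_bool (n = k))"

lemma unit_seq_in_vexp_space: "unit_seq k \<in> vexp_space p"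
  by (rule vexp_space_finite_support) (auto simp: unit_seq_def)

lemma modular_unit_seq: "modular p (unit_seq k) = 1"
proof -
  have "(\<lambda>n. cmod (unit_seq k n) powr p n) = (\<lambda>n. if n = k then 1 else 0)"
    by (auto simp: unit_seq_def)
  then show ?thesis
    using sums_single[of k "\<lambda>_. 1::real"] by (simp add: modular_def sums_iff)
qed

section \<open>Disjoint supports and coordinatewise series under an isomodular operator\<close>

context
  fixes p :: "nat \<Rightarrow> real" and S :: "(nat \<Rightarrow> complex) \<Rightarrow> (nat \<Rightarrow> complex)"
  assumes S: "isomodular p S"
begin

lemma isomodular_closed: "x \<in> vexp_space p \<Longrightarrow> S x \<in> vexp_space p"
  using S by (auto simp: isomodular_def linear_operator_def)

lemma isomodular_modular: "x \<in> vexp_space p \<Longrightarrow> modular p (S x) = modular p x"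
  using S by (auto simp: isomodular_def)

lemma isomodular_add:
  "\<lbrakk>x \<in> vexp_space p; y \<in> vexp_space p; (\<lambda>n. x n + y n) \<in> vexp_space p\<rbrakk>
    \<Longrightarrow> S (\<lambda>n. x n + y n) = (\<lambda>n. S x n + S y n)"
  using S by (auto simp: isomodular_def linear_operator_def)

lemma isomodular_scale:
  "\<lbrakk>x \<in> vexp_space p; (\<lambda>n. c * x n) \<in> vexp_space p\<rbrakk>
    \<Longrightarrow> S (\<lambda>n. c * x n) = (\<lambda>n. c * S x n)"
  using S by (auto simp: isomodular_def linear_operator_def)

lemma isomodular_disjoint:
  assumes p: "(\<forall>n. p n \<in> {1..<2}) \<or> (\<forall>n. p n \<in> {2<..})"
    and x: "x \<in> vexp_space p" and y: "y \<in> vexp_space p"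
    and disj: "\<And>n. x n = 0 \<or> y n = 0"
  shows "S x n = 0 \<or> S y n = 0"
proof -
  \<comment> \<open>Writing -y as a scalar multiple lets homogeneity and additivity yield S (x - y)
    = S x - S y.\<close>
  define y' where "y' = (\<lambda>n. (-1) * y n)"
  have y': "y' \<in> vexp_space p" and "modular p y' = modular p y"
    using y by (simp_all add: y'_def vexp_space_def modular_def)
  note xy = vexp_space_add_disjoint[OF x y disj] vexp_space_add_disjoint[OF x y']
  have disj': "x n = 0 \<or> y' n = 0" for n
    using disj by (simp add: y'_def)
  have S_y': "S y' = (\<lambda>n. - S y n)"
    using isomodular_scale[OF y, of "-1"] y' by (simp add: y'_def)
  have S_add: "S (\<lambda>n. x n + y n) = (\<lambda>n. S x n + S y n)"
    by (intro isomodular_add x y xy)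
  have S_diff: "S (\<lambda>n. x n + y' n) = (\<lambda>n. S x n - S y n)"
    using isomodular_add[OF x y' xy(2)[OF disj']] by (simp add: S_y')
  define f where "f = (\<lambda>n. cmod (S x n + S y n) powr p n + cmod (S x n - S y n) powr p n)"
  define g where "g = (\<lambda>n. 2 * (cmod (S x n) powr p n + cmod (S y n) powr p n))"
  have summ:
    "summable (\<lambda>n. cmod (S x n) powr p n)" "summable (\<lambda>n. cmod (S y n) powr p n)"
    "summable (\<lambda>n. cmod (S x n + S y n) powr p n)" "summable (\<lambda>n. cmod (S x n - S y n) powr p n)"
    using vexp_spaceD[OF isomodular_closed[OF x]] vexp_spaceD[OF isomodular_closed[OF y]]
      vexp_spaceD[OF isomodular_closed[OF xy(1)]] vexp_spaceD[OF isomodular_closed[OF xy(2)[OF disj']]]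
    by (simp_all add: S_add S_diff)
  have sf: "summable f" and sg: "summable g"
    unfolding f_def g_def by (intro summable_add summable_mult summ)+
  have "suminf f = modular p (S (\<lambda>n. x n + y n)) + modular p (S (\<lambda>n. x n + y' n))"
    by (simp add: f_def modular_def S_add S_diff suminf_add summ)
  also have "\<dots> = 2 * (modular p x + modular p y)"
    using \<open>modular p y' = modular p y\<close>
    by (simp add: isomodular_modular xy disj' modular_add_disjoint x y y' disj)
  also have "\<dots> = 2 * (modular p (S x) + modular p (S y))"
    by (simp add: isomodular_modular x y)
  also have "\<dots> = suminf g"
    unfolding g_def modular_def by (subst suminf_mult) (simp_all add: suminf_add summable_add summ)
  finally have eq: "suminf f = suminf g" .
  \<comment> \<open>The alternative for \<open>p\<close> fixes one direction of the Clarkson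
    inequality in all coordinates, so equal sums force equal terms.\<close>
  have "f n = g n"
    using p
  proof
    assume p: "\<forall>n. p n \<in> {1..<2}"
    have "f m \<le> g m" for m
      using clarkson_less[of "p m" "S x m" "S y m"] clarkson_eq[of "S x m" "S y m" "p m"] p[rule_format, of m]
      unfolding f_def g_def by fastforce
    then show ?thesis using suminf_eq_imp_eq[OF sf sg] eq by blast
  next
    assume p: "\<forall>n. p n \<in> {2<..}"
    have "g m \<le> f m" for m
      using clarkson_greater[of "p m" "S x m" "S y m"] clarkson_eq[of "S x m" "S y m" "p m"] p[rule_format, of m]
      unfolding f_def g_def by fastforce
    then show ?thesis using suminf_eq_imp_eq[OF sg sf] eq by simp
  qed
  moreover have "p n \<in> {1..<2} \<or> p n \<in> {2<..}"
    using p by blast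
  \<comment> \<open>Two nonzero values would make the inequality strict at \<open>n\<close>.\<close>
  ultimately show ?thesis
    using clarkson_less[of "p n" "S x n" "S y n"] clarkson_greater[of "p n" "S x n" "S y n"]
    unfolding f_def g_def by fastforce
qed

text \<open>All sequences in the induction have finite support, hence lie in the space whatever
  \<open>x\<close> is, and linearity applies.\<close>

lemma isomodular_truncation:
  "S (\<lambda>m. if m < N then x m else 0) n = (\<Sum>k<N. x k * S (unit_seq k) n)"
proof (induction N)
  case 0
  \<comment> \<open>The zero sequence is a zero multiple of a unit vector, so homogeneity gives S 0
    = 0.\<close>
  have "S (\<lambda>m. 0 * unit_seq 0 m) = (\<lambda>m. 0 * S (unit_seq 0) m)"
    by (rule isomodular_scale) (auto intro: vexp_space_finite_support unit_seq_in_vexp_space)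
  then show ?case by simp
next
  case (Suc N)
  have eq: "(\<lambda>m. if m < Suc N then x m else 0) =
      (\<lambda>m. (if m < N then x m else 0) + x N * unit_seq N m)"
    by (auto simp: unit_seq_def fun_eq_iff less_Suc_eq)
  have unit: "(\<lambda>m. x N * unit_seq N m) \<in> vexp_space p"
    by (rule vexp_space_finite_support, rule finite_subset[of _ "{N}"]) (auto simp: unit_seq_def)
  have trunc: "(\<lambda>m. if m < M then x m else 0) \<in> vexp_space p" for M
    by (rule vexp_space_finite_support, rule finite_subset[of _ "{..M}"]) auto
  have "S (\<lambda>m. if m < Suc N then x m else 0) =
      (\<lambda>m. S (\<lambda>m. if m < N then x m else 0) m + S (\<lambda>m. x N * unit_seq N m) m)"
    unfolding eq by (intro isomodular_add trunc unit trunc[of "Suc N", unfolded eq])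
  also have "S (\<lambda>m. x N * unit_seq N m) = (\<lambda>m. x N * S (unit_seq N) m)"
    by (intro isomodular_scale unit_seq_in_vexp_space unit)
  finally show ?case by (simp add: Suc)
qed

text \<open>The modular replaces continuity in a norm: each coordinate of the image of a tail is
  controlled by the modular of that tail.\<close>

lemma isomodular_sums:
  assumes p: "\<And>n. p n > 0" and x: "x \<in> vexp_space p"
  shows "(\<lambda>k. x k * S (unit_seq k) n) sums S x n"
proof -
  define f where "f = (\<lambda>n. cmod (x n) powr p n)"
  define r where "r = (\<lambda>N m. if m < N then 0 else x m)"
  define t where "t = (\<lambda>N. \<Sum>i. f (i + N))"
  have f: "summable f"
    using x by (simp add: f_def vexp_spaceD)
  have r: "r N \<in> vexp_space p" for N
    using x by (rule vexp_space_mono) (auto simp: r_def p less_imp_le)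
  have modular_r: "modular p (r N) = t N" for N
  proof -
    have "modular p (r N) = (\<Sum>i. cmod (r N (i + N)) powr p (i + N)) + (\<Sum>i<N. cmod (r N i) powr p i)"
      unfolding modular_def by (rule suminf_split_initial_segment[OF vexp_spaceD[OF r]])
    then show ?thesis by (simp add: r_def t_def f_def)
  qed
  have "t \<longlonglongrightarrow> 0"
    unfolding t_def using f by (rule suminf_exist_split2)
  \<comment> \<open>One summand is at most the whole modular; then take the root of order
    \<open>p n\<close>.\<close>
  have bound: "cmod (S (r N) n) \<le> t N powr (1 / p n)" for N
  proof -
    have "cmod (S (r N) n) powr p n \<le> modular p (S (r N))"
      using sum_le_suminf[OF vexp_spaceD[OF isomodular_closed[OF r[of N]]], of "{n}"]
      by (simp add: modular_def)
    also have "\<dots> = t N"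
      by (simp add: isomodular_modular r modular_r)
    finally have "(cmod (S (r N) n) powr p n) powr (1 / p n) \<le> t N powr (1 / p n)"
      using p[of n] by (intro powr_mono2) auto
    then show ?thesis using p[of n] by (simp add: powr_powr)
  qed
  \<comment> \<open>The coordinate \<open>n\<close> is fixed, so the exponent is a positive constant
    even when \<open>p\<close> is unbounded.\<close>
  have "(\<lambda>N. t N powr (1 / p n)) \<longlonglongrightarrow> 0 powr (1 / p n)"
  proof (rule tendsto_powr2[OF \<open>t \<longlonglongrightarrow> 0\<close> tendsto_const])
    show "\<forall>\<^sub>F N in sequentially. 0 \<le> t N"
      unfolding t_def f_def
      using summable_ignore_initial_segment[OF f] by (intro always_eventually allI suminf_nonneg) (auto simp: f_def)
  qed (use p in auto)
  then have lim: "(\<lambda>N. S (r N) n) \<longlonglongrightarrow> 0"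
    by (intro Lim_null_comparison[OF always_eventually[OF allI[OF bound]]]) simp
  have "(\<Sum>k<N. x k * S (unit_seq k) n) = S x n - S (r N) n" for N
  proof -
    let ?c = "\<lambda>m. if m < N then x m else 0"
    have c: "?c \<in> vexp_space p"
      using x by (rule vexp_space_mono) (auto simp: p less_imp_le)
    have eq: "(\<lambda>m. ?c m + r N m) = x"
      by (auto simp: r_def)
    have "S x = (\<lambda>m. S ?c m + S (r N) m)"
      using isomodular_add[OF c r[of N]] x unfolding eq by blast
    then show ?thesis
      using isomodular_truncation[of N x n] by simp
  qed
  then show ?thesis
    unfolding sums_def using tendsto_diff[OF tendsto_const lim, of "S x n"] by simp
qed

end

section \<open>The set isomorphism and the weight obtained from the images of unit vectors\<close>

theorem theorem1p6:
  fixes p :: "nat \<Rightarrow> real"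
    and S :: "(nat \<Rightarrow> complex) \<Rightarrow> (nat \<Rightarrow> complex)"
  assumes "(\<forall>n. p n \<in> {1..<2}) \<or> (\<forall>n. p n \<in> {2<..})"
    and "isomodular p S"
  shows "\<exists>T h. regular_set_isomorphism T \<and> h \<in> ell_infinity \<and>
           (\<forall>x \<in> vexp_space p. \<forall>n. S x n = h n * induced_map T x n) \<and>
           (\<forall>n. cmod (h n) \<le> 1)"
proof -
  have p: "p n > 0" for n
    using assms(1) by (auto dest!: spec[of _ n])
  define b where "b = (\<lambda>k. S (unit_seq k))"
  have b_unique: "j = k" if "b j n \<noteq> 0" "b k n \<noteq> 0" for j k n
  proof (rule ccontr)
    assume "j \<noteq> k"
    then have "S (unit_seq j) n = 0 \<or> S (unit_seq k) n = 0"
      by (intro isomodular_disjoint[OF assms(2,1)] unit_seq_in_vexp_space) (auto simp: unit_seq_def)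
    with that show False by (simp add: b_def)
  qed
  have b_in: "b k \<in> vexp_space p" and modular_b: "modular p (b k) = 1" for k
    by (simp_all add: b_def isomodular_closed[OF assms(2)] isomodular_modular[OF assms(2)]
        unit_seq_in_vexp_space modular_unit_seq)
  have b_nonzero: "\<exists>n. b k n \<noteq> 0" for k
  proof (rule ccontr)
    assume "\<nexists>n. b k n \<noteq> 0"
    then show False using modular_b[of k] by (simp add: modular_def)
  qed
  have b_le: "cmod (b k n) \<le> 1" for k n
  proof -
    have "cmod (b k n) powr p n \<le> 1"
      using sum_le_suminf[OF vexp_spaceD[OF b_in[of k]], of "{n}"] modular_b[of k]
      by (simp add: modular_def)
    then show ?thesis
      using p[of n] powr_less_mono2[of "p n" 1 "cmod (b k n)"] by fastforce
  qed
  \<comment> \<open>\<open>T A\<close> collects the supports of the images of the unit vectors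
    indexed by \<open>A\<close>.\<close>
  define T where "T = (\<lambda>A. {n. \<exists>k\<in>A. b k n \<noteq> 0})"
  \<comment> \<open>By \<open>b_unique\<close> at most one \<open>b k\<close> is nonzero at
    \<open>n\<close>; the default 0 covers points outside all supports, where \<open>S x\<close>
    vanishes too.\<close>
  define h where "h = (\<lambda>n. if \<exists>k. b k n \<noteq> 0 then b (THE k. b k n \<noteq> 0) n else 0)"
  have T: "regular_set_isomorphism T"
    unfolding regular_set_isomorphism_def
  proof (intro conjI allI)
    \<comment> \<open>Complements are respected because every point of \<open>T UNIV\<close> lies in
      exactly one support.\<close>
    show "T (UNIV - A) = T UNIV - T A" for A
      using b_unique by (fastforce simp: T_def)
    show "T (\<Union>n. A n) = (\<Union>n. T (A n))" for A :: "nat \<Rightarrow> nat set"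
      by (auto simp: T_def)
    show "T A = {} \<longleftrightarrow> A = {}" for A
      using b_nonzero by (auto simp: T_def)
  qed
  have h_le: "cmod (h n) \<le> 1" for n
    by (simp add: h_def b_le)
  have h_eq: "h n = b k n" if "b k n \<noteq> 0" for k n
  proof -
    have "(THE k. b k n \<noteq> 0) = k"
      using that b_unique by (intro the_equality) auto
    with that show ?thesis by (auto simp: h_def)
  qed
  have "S x n = h n * induced_map T x n" if x: "x \<in> vexp_space p" for x n
  proof -
    have sums: "(\<lambda>k. x k * b k n) sums S x n"
      unfolding b_def by (rule isomodular_sums[OF assms(2) p x])
    show ?thesis
    proof (cases "\<exists>k. b k n \<noteq> 0")
      case True
      then obtain k where k: "b k n \<noteq> 0" by blast
      \<comment> \<open>Disjointness of the supports leaves a single term of the series at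
        \<open>n\<close>.\<close>
      then have "(\<lambda>j. x j * b j n) = (\<lambda>j. if j = k then x j * b j n else 0)"
        using b_unique by fastforce
      then have "(\<lambda>j. x j * b j n) sums (x k * b k n)"
        using sums_single[of k "\<lambda>j. x j * b j n"] by simp
      then have "S x n = x k * b k n"
        using sums sums_unique2 by blast
      moreover have "induced_map T x n = x k"
        using k by (intro induced_map_eq[OF T]) (simp add: T_def)
      ultimately show ?thesis
        by (simp add: h_eq[OF k])
    next
      case False
      then show ?thesis
        using sums sums_unique2[OF sums_zero] by (simp add: h_def)
    qed
  qed
  moreover have "h \<in> ell_infinity"
    unfolding ell_infinity_def bounded_iff using h_le by blast
  ultimately show ?thesis
    using T h_le by blast
qed

end
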